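(* Let $X$ be a separable Banach space and let $\emptyset\neq M\subset X$ be boundedly weakly compact. Assume that $M$ is $\mathrm{m}$-connected. Then $M$ is monotone path-connected.
   Context: All normed spaces are real. $\operatorname{ext}S^*$ is the set of extreme points of the unit ball of the dual $X^*$ (the extreme points of the dual unit sphere $S^*$). For a nonempty bounded $A\subset X$, $\mathrm{m}(A)$ is the intersection of all closed balls of $X$ containing $A$; $\mathrm{m}(x,y):=\mathrm{m}(\{x,y\})$. A set $M\subset X$ is $\mathrm{m}$-connected (Menger-connected) if $\mathrm{m}(x,y)\cap M\neq\{x,y\}$ for any two distinct $x,y\in M$. A set is boundedly weakly compact if its intersection with every closed ball is weakly compact. A continuous curve $k(\tau)$, $0\le\tau\le1$, in the normed space $X$ is monotone if $\tau\mapsto f(k(\tau))$ is a monotone function for every $f\in\operatorname{ext}S^*$. A closed set $M$ is monotone path-connected if any two of its points can be connected by a continuous monotone curve lying in $M$. *)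

theory Defs
  imports "HOL-Analysis.Analysis"
begin

text \<open>The dual of a real normed space \<open>'a\<close> is the type \<open>'a \<Rightarrow>\<^sub>L real\<close> with the operator norm.\<close>

definition ext_dual :: "('a::real_normed_vector \<Rightarrow>\<^sub>L real) set" where
  "ext_dual = {f. f extreme_point_of cball 0 1}"

definition weak_topology :: "'a::real_normed_vector topology" where
  "weak_topology =
    topology_generated_by {blinfun_apply f -` U | (f :: 'a \<Rightarrow>\<^sub>L real) U. open U}"

lemma topspace_weak_topology [simp]:
  "topspace (weak_topology :: 'a::real_normed_vector topology) = UNIV"
proof -
  have "UNIV \<in> {blinfun_apply f -` U | (f :: 'a \<Rightarrow>\<^sub>L real) U. open U}"
    by (rule CollectI, rule exI[of _ 0], rule exI[of _ UNIV]) simp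
  then show ?thesis
    unfolding weak_topology_def topology_generated_by_topspace by blast
qed

definition boundedly_weakly_compact :: "'a::real_normed_vector set \<Rightarrow> bool" where
  "boundedly_weakly_compact M \<longleftrightarrow> (\<forall>c r. compactin weak_topology (M \<inter> cball c r))"

text \<open>The ball hull is only meant for nonempty bounded \<open>A\<close>.\<close>

definition m_hull :: "'a::real_normed_vector set \<Rightarrow> 'a set" where
  "m_hull A = \<Inter>{cball c r | c r. A \<subseteq> cball c r}"

definition m_connected :: "'a::real_normed_vector set \<Rightarrow> bool" where
  "m_connected M \<longleftrightarrow>
    (\<forall>x\<in>M. \<forall>y\<in>M. x \<noteq> y \<longrightarrow> m_hull {x, y} \<inter> M \<noteq> {x, y})"

text \<open>Whether \<open>f \<circ> k\<close> increases or decreases may depend on \<open>f\<close>.\<close>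

definition monotone_curve :: "(real \<Rightarrow> 'a::real_normed_vector) \<Rightarrow> bool" where
  "monotone_curve k \<longleftrightarrow> path k \<and>
    (\<forall>f\<in>ext_dual. mono_on {0..1} (\<lambda>\<tau>. blinfun_apply f (k \<tau>)) \<or>
                  antimono_on {0..1} (\<lambda>\<tau>. blinfun_apply f (k \<tau>)))"

text \<open>The notion is defined for closed sets only, so closedness is part of the predicate.\<close>

definition monotone_path_connected :: "'a::real_normed_vector set \<Rightarrow> bool" where
  "monotone_path_connected M \<longleftrightarrow> closed M \<and>
    (\<forall>x\<in>M. \<forall>y\<in>M. \<exists>k. monotone_curve k \<and> path_image k \<subseteq> M \<and>
                          pathstart k = x \<and> pathfinish k = y)"

end

theory Submission
  imports Defs
begin

text \<open>Write \<open>u \<le> v\<close> if \<open>g u \<le> g v\<close> for all \<open>g\<close> in a suitable countable family of functionals of norm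
at most one. A monotone curve from \<open>x\<close> to \<open>y\<close> is a maximal chain of the order interval between
\<open>x\<close> and \<open>y\<close> in \<open>M\<close>, parametrised by a strictly increasing functional. Three things make this work.

\<^item> \<^emph>\<open>Which functionals.\<close> At a point \<open>c\<close> where the norm is Gateaux differentiable, with derivative \<open>f\<close>,
the balls of radius \<open>norm c / t + a\<close> centred at \<open>- c / t\<close> approximate the half-space
\<open>f \<le> a\<close> as \<open>t > 0\<close> tends to \<open>0\<close>. So every point of
the ball hull of \<open>{x, y}\<close> has its \<open>f\<close>-value between those of \<open>x\<close> and \<open>y\<close>
(\<open>norm_rderiv_m_hull_le\<close>). In a separable Banach space such points \<open>c\<close> are dense
(\<open>smooth_points_dense\<close>, a Baire category argument), and the derivatives at countably many of them
already recover the norm (\<open>countable_norming_hull_functionals\<close>). After a change of signs, all of them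
are at most as large at \<open>x\<close> as at \<open>y\<close>, and \<open>\<le>\<close> is the resulting order.

\<^item> \<^emph>\<open>The curve.\<close> \<open>M\<close> is Menger-connected, so the order interval between \<open>x\<close> and \<open>y\<close>, cut
down to a ball, is order-dense. A maximal chain in it is weakly compact, being closed by maximality. A
weighted sum of the functionals is strictly increasing, hence embeds the chain into the line; the
image is compact and, again by maximality, has no gaps. The inverse of this embedding is a weakly
continuous increasing parametrisation by an interval (\<open>order_arc\<close>).

\<^item> \<^emph>\<open>From the family to all of the dual ball.\<close> The functionals of norm at most one that are monotone
along the curve form a weak-star compact set which is norming. By a theorem of Milman such a set
contains all extreme points of the dual ball (\<open>ext_dual_subset_norming\<close>), which gives monotonicity.
Norm continuity comes from the same compactness: it makes the pointwise, monotone convergence of the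
functionals along the curve uniform, as in Dini's theorem (\<open>uniform_small_oscillation\<close>).\<close>

section \<open>Norming sets and extreme points of the dual ball\<close>

text \<open>The supremum need not be attained, so that countable sets can be norming.\<close>

definition norming :: "('a::real_normed_vector \<Rightarrow>\<^sub>L real) set \<Rightarrow> bool" where
  "norming T \<longleftrightarrow> (\<forall>x. \<forall>e>0. \<exists>f\<in>T. norm x - e \<le> blinfun_apply f x)"

text \<open>The weak-star topology is the topology of pointwise convergence, which functions carry as elements
of a product space.\<close>

definition wstar_compact :: "('a::real_normed_vector \<Rightarrow>\<^sub>L real) set \<Rightarrow> bool" where
  "wstar_compact T \<longleftrightarrow> compact (blinfun_apply ` T)"

lemma continuous_on_eval [continuous_intros]:
  "continuous_on S (\<lambda>g::'a \<Rightarrow> 'b::topological_space. g x)"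
  by (rule continuous_on_subset[OF continuous_on_product_coordinates subset_UNIV])

lemma blinfun_le_norm:
  assumes "f \<in> cball (0::'a::real_normed_vector \<Rightarrow>\<^sub>L real) 1"
  shows "\<bar>blinfun_apply f x\<bar> \<le> norm x"
proof -
  have "\<bar>blinfun_apply f x\<bar> \<le> norm f * norm x"
    using norm_blinfun[of f x] by simp
  also have "\<dots> \<le> 1 * norm x"
    using assms by (intro mult_right_mono) auto
  finally show ?thesis by simp
qed

lemma norming_bound_imp_norm_le:
  assumes "norming T" "\<And>f. f \<in> T \<Longrightarrow> blinfun_apply f x \<le> e"
  shows "norm x \<le> e"
proof (rule field_le_epsilon)
  fix d :: real assume "d > 0"
  then obtain f where "f \<in> T" "norm x - d \<le> blinfun_apply f x"
    using assms(1) unfolding norming_def by blast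
  then show "norm x \<le> e + d" using assms(2)[of f] by simp
qed

lemma image_blinfun_apply_cball:
  "blinfun_apply ` cball (0::'a::real_normed_vector \<Rightarrow>\<^sub>L real) 1 =
     {g. linear g \<and> (\<forall>x. \<bar>g x\<bar> \<le> norm x)}"
proof safe
  fix g :: "'a \<Rightarrow> real" assume g: "linear g" "\<forall>x. \<bar>g x\<bar> \<le> norm x"
  have bl: "bounded_linear g"
    using g by (intro bounded_linear.intro bounded_linear_axioms.intro exI[of _ 1]) auto
  have "norm (Blinfun g) \<le> 1"
    using g bl by (intro norm_blinfun_bound) (auto simp: bounded_linear_Blinfun_apply)
  then show "g \<in> blinfun_apply ` cball 0 1"
    using bl by (intro image_eqI[of _ _ "Blinfun g"]) (auto simp: bounded_linear_Blinfun_apply)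
next
  fix f :: "'a \<Rightarrow>\<^sub>L real" assume f: "f \<in> cball 0 1"
  show "linear (blinfun_apply f)"
    by (simp add: blinfun.bounded_linear_right bounded_linear.linear)
  fix x show "\<bar>blinfun_apply f x\<bar> \<le> norm x" by (rule blinfun_le_norm[OF f])
qed

text \<open>Banach--Alaoglu: the dual ball is a closed subset of the product of the intervals
\<open>[- norm x, norm x]\<close>, which is compact by Tychonoff's theorem.\<close>

lemma wstar_compact_dual_ball: "wstar_compact (cball (0::'a::real_normed_vector \<Rightarrow>\<^sub>L real) 1)"
proof -
  let ?P = "PiE UNIV (\<lambda>x::'a. {- norm x..norm x})"
  have "compactin (product_topology (\<lambda>_. euclidean) UNIV) ?P"
    by (subst compactin_PiE) auto
  then have P: "compact ?P" by (simp add: euclidean_product_topology)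
  have eq: "blinfun_apply ` cball (0::'a \<Rightarrow>\<^sub>L real) 1 =
      ?P \<inter> {g. (\<forall>x y. g (x + y) = g x + g y) \<and> (\<forall>c x. g (c *\<^sub>R x) = c *\<^sub>R g x)}"
    unfolding image_blinfun_apply_cball linear_iff by (auto simp: PiE_iff abs_le_iff minus_le_iff)
  have "closed {g::'a \<Rightarrow> real. (\<forall>x y. g (x + y) = g x + g y) \<and> (\<forall>c x. g (c *\<^sub>R x) = c *\<^sub>R g x)}"
    by (intro closed_Collect_conj closed_Collect_all closed_Collect_eq continuous_intros)
  then show ?thesis
    unfolding wstar_compact_def eq using P by (rule compact_Int_closed[rotated])
qed

lemma wstar_compact_Int_closed:
  assumes "wstar_compact T" "closed C"
  shows "wstar_compact {f\<in>T. blinfun_apply f \<in> C}"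
proof -
  have "blinfun_apply ` {f\<in>T. blinfun_apply f \<in> C} = blinfun_apply ` T \<inter> C" by auto
  then show ?thesis using assms by (simp add: wstar_compact_def compact_Int_closed)
qed

lemma wstar_compact_slice:
  assumes "wstar_compact T"
  shows "wstar_compact {f\<in>T. c \<le> blinfun_apply f x}"
proof -
  have "closed {g::'a \<Rightarrow> real. c \<le> g x}"
    by (intro closed_Collect_le continuous_intros)
  from wstar_compact_Int_closed[OF assms this] show ?thesis by simp
qed

text \<open>A least-squares substitute for separating \<open>f\<close> from \<open>Q\<close> by a vector. Let \<open>g0\<close> minimise the sum of squared
errors \<open>a j = g0 j - f j\<close> over \<open>Q\<close>. The variational inequality says that \<open>g0\<close> maximises, over
\<open>Q\<close>, the evaluation at the vector \<open>x = - (\<Sum>j. a j *\<^sub>R j)\<close>. As \<open>Q\<close> is norming, \<open>f x \<le> norm x \<le> g0 x\<close>; but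
\<open>f x - g0 x\<close> is the sum of the \<open>(a j)\<^sup>2\<close>, which therefore vanishes.\<close>

lemma least_squares_match:
  fixes f :: "'a::real_normed_vector \<Rightarrow>\<^sub>L real"
  assumes Q: "convex Q" "wstar_compact Q" "norming Q"
    and f: "f \<in> cball 0 1" and J: "finite J"
  shows "\<exists>g\<in>Q. \<forall>j\<in>J. blinfun_apply g j = blinfun_apply f j"
proof -
  have ne: "blinfun_apply ` Q \<noteq> {}"
    using Q(3) unfolding norming_def by (metis image_is_empty ex_in_conv zero_less_one)
  have "continuous_on (blinfun_apply ` Q) (\<lambda>g. \<Sum>j\<in>J. (g j - blinfun_apply f j)\<^sup>2)"
    by (intro continuous_intros)
  from continuous_attains_inf[OF _ ne this] Q(2)
  obtain g0 where g0: "g0 \<in> Q" and min: "\<And>g. g \<in> Q \<Longrightarrow>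
      (\<Sum>j\<in>J. (blinfun_apply g0 j - blinfun_apply f j)\<^sup>2) \<le> (\<Sum>j\<in>J. (blinfun_apply g j - blinfun_apply f j)\<^sup>2)"
    unfolding wstar_compact_def by auto
  define a where "a j = blinfun_apply g0 j - blinfun_apply f j" for j
  have var: "0 \<le> (\<Sum>j\<in>J. a j * (blinfun_apply g j - blinfun_apply g0 j))" if g: "g \<in> Q" for g
  proof -
    define b where "b j = blinfun_apply g j - blinfun_apply g0 j" for j
    define A where "A = (\<Sum>j\<in>J. a j * b j)"
    define B where "B = (\<Sum>j\<in>J. (b j)\<^sup>2)"
    \<comment> \<open>Moving from \<open>g0\<close> towards \<open>g\<close> by \<open>t\<close> changes the error by \<open>t * (2 * A + t * B)\<close>.\<close>
    have *: "0 \<le> 2 * A + t * B" if t: "0 < t" "t \<le> 1" for t :: real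
    proof -
      have "(1 - t) *\<^sub>R g0 + t *\<^sub>R g \<in> Q"
        using convexD[OF Q(1) g0 g, of "1 - t" t] t by auto
      note le = min[OF this]
      have eq: "blinfun_apply ((1 - t) *\<^sub>R g0 + t *\<^sub>R g) j - blinfun_apply f j = a j + t * b j" for j
        unfolding a_def b_def blinfun.add_left blinfun.scaleR_left by (simp add: algebra_simps)
      have "(\<Sum>j\<in>J. (a j)\<^sup>2) \<le> (\<Sum>j\<in>J. (a j + t * b j)\<^sup>2)"
        using le unfolding eq by (simp only: a_def)
      also have "\<dots> = (\<Sum>j\<in>J. (a j)\<^sup>2) + t * (2 * A + t * B)"
        by (simp add: A_def B_def sum.distrib sum_distrib_left power2_eq_square algebra_simps)
      finally show ?thesis using t by (simp add: zero_le_mult_iff)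
    qed
    have "((\<lambda>t. 2 * A + t * B) \<longlongrightarrow> 2 * A + 0 * B) (at_right 0)"
      by (intro tendsto_intros)
    moreover have "eventually (\<lambda>t. 0 \<le> 2 * A + t * B) (at_right 0)"
      using * eventually_at_right_less[of 0] eventually_at_rightI[of 0 1] by (metis greaterThanLessThan_iff less_imp_le zero_less_one)
    ultimately have "0 \<le> 2 * A + 0 * B"
      by (rule tendsto_lowerbound) simp
    then show ?thesis by (simp add: A_def b_def)
  qed
  define x where "x = - (\<Sum>j\<in>J. a j *\<^sub>R j)"
  have ev: "blinfun_apply g x = - (\<Sum>j\<in>J. a j * blinfun_apply g j)" for g :: "'a \<Rightarrow>\<^sub>L real"
    by (simp add: x_def blinfun.minus_right blinfun.sum_right blinfun.scaleR_right)
  have "blinfun_apply g x \<le> blinfun_apply g0 x" if "g \<in> Q" for g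
    using var[OF that] by (simp add: ev right_diff_distrib sum_subtractf)
  then have "norm x \<le> blinfun_apply g0 x"
    by (rule norming_bound_imp_norm_le[OF Q(3)])
  then have "blinfun_apply f x \<le> blinfun_apply g0 x"
    using blinfun_le_norm[OF f, of x] by simp
  then have "(\<Sum>j\<in>J. (a j)\<^sup>2) \<le> 0"
    by (simp add: ev a_def power2_eq_square right_diff_distrib sum_subtractf)
  then have "\<forall>j\<in>J. (a j)\<^sup>2 = 0"
    using sum_nonneg_eq_0_iff[OF J, of "\<lambda>j. (a j)\<^sup>2"] by (simp add: sum_nonneg order_antisym)
  then show ?thesis using g0 by (auto simp: a_def)
qed

text \<open>Compactness turns matching \<open>f\<close> on every finite set into matching it everywhere.\<close>

lemma norming_convex_contains_dual_ball:
  assumes Q: "convex Q" "wstar_compact Q" "norming Q"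
  shows "cball (0::'a::real_normed_vector \<Rightarrow>\<^sub>L real) 1 \<subseteq> Q"
proof
  fix f :: "'a \<Rightarrow>\<^sub>L real" assume f: "f \<in> cball 0 1"
  have "blinfun_apply ` Q \<inter> (\<Inter>j\<in>UNIV. {g. g j = blinfun_apply f j}) \<noteq> {}"
  proof (rule compact_imp_fip_image)
    show "compact (blinfun_apply ` Q)" using Q(2) by (simp add: wstar_compact_def)
    show "closed {g. g j = blinfun_apply f j}" for j
      by (intro closed_Collect_eq continuous_intros)
    fix J :: "'a set" assume "finite J"
    from least_squares_match[OF Q f this]
    show "blinfun_apply ` Q \<inter> (\<Inter>j\<in>J. {g. g j = blinfun_apply f j}) \<noteq> {}" by auto
  qed
  then obtain g where "g \<in> Q" "\<And>j. blinfun_apply g j = blinfun_apply f j" by auto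
  then show "f \<in> Q" using blinfun_eqI[of g f] by simp
qed

text \<open>Not stated with the quotients by \<open>s + t\<close>, because this sum may vanish.\<close>

lemma convex_scale_combine:
  assumes "convex A" "a \<in> A" "b \<in> A" "0 \<le> s" "0 \<le> t"
  obtains c where "c \<in> A" "s *\<^sub>R a + t *\<^sub>R b = (s + t) *\<^sub>R c"
proof (cases "s + t = 0")
  case True
  then have "s = 0" "t = 0" using assms by auto
  then show ?thesis using that[of a] assms by simp
next
  case False
  then have "(s / (s + t)) *\<^sub>R a + (t / (s + t)) *\<^sub>R b \<in> A"
    using assms by (intro convexD) (auto simp flip: add_divide_distrib)
  then show ?thesis by (rule that) (use False in \<open>simp add: scaleR_add_right\<close>)
qed

lemma convex_hull_Un_convex:
  assumes A: "convex A" "A \<noteq> {}" and B: "convex B" "B \<noteq> {}"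
  shows "convex hull (A \<union> B) =
    {(1 - t) *\<^sub>R a + t *\<^sub>R b | t a b. t \<in> {0..1} \<and> a \<in> A \<and> b \<in> B}" (is "_ = ?J")
proof
  have "convex ?J"
  proof (rule convexI)
    fix p q and u v :: real
    assume "p \<in> ?J" "q \<in> ?J" and uv: "0 \<le> u" "0 \<le> v" "u + v = 1"
    then obtain s a b t c d where p: "p = (1 - s) *\<^sub>R a + s *\<^sub>R b" "s \<in> {0..1}" "a \<in> A" "b \<in> B"
      and q: "q = (1 - t) *\<^sub>R c + t *\<^sub>R d" "t \<in> {0..1}" "c \<in> A" "d \<in> B" by blast
    obtain e where e: "e \<in> A" "(u * (1 - s)) *\<^sub>R a + (v * (1 - t)) *\<^sub>R c = (u * (1 - s) + v * (1 - t)) *\<^sub>R e"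
      using convex_scale_combine[OF A(1) p(3) q(3), of "u * (1 - s)" "v * (1 - t)"] uv p(2) q(2) by auto
    obtain f where f: "f \<in> B" "(u * s) *\<^sub>R b + (v * t) *\<^sub>R d = (u * s + v * t) *\<^sub>R f"
      using convex_scale_combine[OF B(1) p(4) q(4), of "u * s" "v * t"] uv p(2) q(2) by auto
    have *: "1 - (u * s + v * t) = u * (1 - s) + v * (1 - t)"
      using uv by (simp add: algebra_simps)
    moreover have "0 \<le> u * (1 - s) + v * (1 - t)" using uv p(2) q(2) by auto
    moreover have "0 \<le> u * s + v * t" using uv p(2) q(2) by auto
    ultimately have "u * s + v * t \<in> {0..1}" unfolding atLeastAtMost_iff by linarith
    have "u *\<^sub>R p + v *\<^sub>R q = (1 - (u * s + v * t)) *\<^sub>R e + (u * s + v * t) *\<^sub>R f"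
      unfolding * e(2)[symmetric] f(2)[symmetric] p(1) q(1) by (simp add: scaleR_add_right)
    then show "u *\<^sub>R p + v *\<^sub>R q \<in> ?J" using e(1) f(1) \<open>u * s + v * t \<in> {0..1}\<close> by blast
  qed
  moreover have "A \<subseteq> ?J"
  proof
    fix a assume "a \<in> A"
    moreover obtain b where "b \<in> B" using B(2) by blast
    ultimately show "a \<in> ?J"
      by (intro CollectI exI[of _ 0] exI[of _ a] exI[of _ b]) simp
  qed
  moreover have "B \<subseteq> ?J"
  proof
    fix b assume "b \<in> B"
    moreover obtain a where "a \<in> A" using A(2) by blast
    ultimately show "b \<in> ?J"
      by (intro CollectI exI[of _ 1] exI[of _ a] exI[of _ b]) simp
  qed
  ultimately show "convex hull (A \<union> B) \<subseteq> ?J" by (intro hull_minimal) auto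
  show "?J \<subseteq> convex hull (A \<union> B)"
  proof clarify
    fix t :: real and a b assume "t \<in> {0..1}" "a \<in> A" "b \<in> B"
    then show "(1 - t) *\<^sub>R a + t *\<^sub>R b \<in> convex hull (A \<union> B)"
      by (intro convexD_alt[OF convex_convex_hull] hull_inc) auto
  qed
qed

text \<open>The hull of two nonempty convex sets \<open>A\<close> and \<open>B\<close> consists of the segments between them, so it is
a continuous image of \<open>{0..1} \<times> A \<times> B\<close>.\<close>

lemma wstar_compact_convex_hull_Union:
  assumes "finite F" "\<And>A. A \<in> F \<Longrightarrow> convex A \<and> wstar_compact A"
  shows "wstar_compact (convex hull (\<Union>F))"
  using assms
proof (induction F)
  case empty
  then show ?case by (simp add: wstar_compact_def)
next
  case (insert A F)
  let ?B = "convex hull (\<Union>F)"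
  have A: "convex A" "wstar_compact A" and B: "wstar_compact ?B"
    using insert by auto
  show ?case
  proof (cases "A = {} \<or> \<Union>F = {}")
    case True
    then show ?thesis
    proof
      assume "A = {}" then show ?thesis using B by simp
    next
      assume "\<Union>F = {}"
      then have "\<Union>(insert A F) = A" by (simp only: Union_insert Un_empty_right)
      then show ?thesis using A by (simp only: hull_same)
    qed
  next
    case False
    let ?m = "\<lambda>(t::real, a, b) x. (1 - t) * a x + t * b x"
    have "convex hull (A \<union> \<Union>F) = convex hull (A \<union> ?B)"
      by (rule hull_Un_right)
    then have hull: "convex hull (A \<union> \<Union>F) =
        {(1 - t) *\<^sub>R a + t *\<^sub>R b | t a b. t \<in> {0..1} \<and> a \<in> A \<and> b \<in> ?B}"
      using convex_hull_Un_convex[of A ?B] A False by simp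
    have m: "blinfun_apply ((1 - t) *\<^sub>R a + t *\<^sub>R b) = ?m (t, blinfun_apply a, blinfun_apply b)" for t a b
      by (simp add: fun_eq_iff blinfun.add_left blinfun.scaleR_left)
    have "blinfun_apply ` (convex hull (A \<union> \<Union>F)) =
        ?m ` ({0..1} \<times> blinfun_apply ` A \<times> blinfun_apply ` ?B)"
    proof (intro equalityI subsetI)
      fix h assume "h \<in> blinfun_apply ` (convex hull (A \<union> \<Union>F))"
      then obtain t a b where "t \<in> {0..1}" "a \<in> A" "b \<in> ?B"
        and h: "h = blinfun_apply ((1 - t) *\<^sub>R a + t *\<^sub>R b)"
        unfolding hull by blast
      then have "(t, blinfun_apply a, blinfun_apply b) \<in> {0..1} \<times> blinfun_apply ` A \<times> blinfun_apply ` ?B"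
        by blast
      then show "h \<in> ?m ` ({0..1} \<times> blinfun_apply ` A \<times> blinfun_apply ` ?B)"
        unfolding h m by (rule imageI)
    next
      fix h assume "h \<in> ?m ` ({0..1} \<times> blinfun_apply ` A \<times> blinfun_apply ` ?B)"
      then obtain t a b where "t \<in> {0..1}" "a \<in> A" "b \<in> ?B"
        "h = ?m (t, blinfun_apply a, blinfun_apply b)" by blast
      then show "h \<in> blinfun_apply ` (convex hull (A \<union> \<Union>F))"
        unfolding hull m[symmetric] by blast
    qed
    moreover have "compact (?m ` ({0..1} \<times> blinfun_apply ` A \<times> blinfun_apply ` ?B))"
    proof (rule compact_continuous_image)
      show "compact ({0..1::real} \<times> blinfun_apply ` A \<times> blinfun_apply ` ?B)"
        using A(2) B by (intro compact_Times) (auto simp: wstar_compact_def)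
      have ev: "continuous_on S (\<lambda>p. fst (snd p) x)" "continuous_on S (\<lambda>p. snd (snd p) x)"
        for x and S :: "(real \<times> ('a \<Rightarrow> real) \<times> ('a \<Rightarrow> real)) set"
        by (rule continuous_on_product_then_coordinatewise, intro continuous_intros)+
      show "continuous_on ({0..1} \<times> blinfun_apply ` A \<times> blinfun_apply ` ?B) ?m"
        unfolding case_prod_beta
        by (intro continuous_on_coordinatewise_then_product continuous_intros ev)
    qed
    ultimately show ?thesis by (simp add: wstar_compact_def)
  qed
qed

text \<open>Milman's argument. If an extreme point \<open>f\<close> is not in \<open>T\<close>, compactness covers \<open>T\<close> by finitely many
slices of the dual ball, each missing \<open>f\<close>. The convex hull of these slices is weak-star compact and
norming, hence is the whole dual ball; but an extreme point of a convex hull belongs to the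
generating set, so \<open>f\<close> lies in one of the slices.\<close>

lemma ext_dual_subset_norming:
  assumes T: "wstar_compact T" "norming T" "T \<subseteq> cball 0 1"
  shows "(ext_dual :: ('a::real_normed_vector \<Rightarrow>\<^sub>L real) set) \<subseteq> T"
proof (rule subsetI, rule ccontr)
  fix f :: "'a \<Rightarrow>\<^sub>L real" assume f: "f \<in> ext_dual" "f \<notin> T"
  let ?U = "\<lambda>(y, c). {g. c < g y}"
  let ?I = "{(y::'a, c). blinfun_apply f y < c}"
  have "blinfun_apply ` T \<subseteq> (\<Union>i\<in>?I. ?U i)"
  proof clarify
    fix g assume "g \<in> T"
    then have "f \<noteq> g" using f by auto
    then obtain y where "blinfun_apply f y \<noteq> blinfun_apply g y"
      using blinfun_eqI by blast
    then have "\<exists>y. blinfun_apply f y < blinfun_apply g y"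
    proof (cases "blinfun_apply f y < blinfun_apply g y")
      case False
      then show ?thesis using \<open>blinfun_apply f y \<noteq> _\<close>
        by (intro exI[of _ "- y"]) (simp add: blinfun.minus_right)
    qed auto
    then obtain y c where "blinfun_apply f y < c" "c < blinfun_apply g y" using dense by blast
    then show "blinfun_apply g \<in> (\<Union>i\<in>?I. ?U i)" by force
  qed
  moreover have "open (?U i)" for i :: "'a \<times> real"
    by (cases i) (auto intro!: open_Collect_less continuous_intros)
  ultimately obtain I where I: "I \<subseteq> ?I" "finite I" "blinfun_apply ` T \<subseteq> (\<Union>i\<in>I. ?U i)"
    using compactE_image[of "blinfun_apply ` T" ?I ?U] T(1) unfolding wstar_compact_def by metis
  let ?H = "\<lambda>(y::'a, c). {g\<in>cball (0::'a \<Rightarrow>\<^sub>L real) 1. c \<le> blinfun_apply g y}"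
  let ?Q = "convex hull (\<Union>(?H ` I))"
  have "convex (?H i) \<and> wstar_compact (?H i)" for i
  proof (cases i)
    case (Pair y c)
    have "?H i = cball 0 1 \<inter> {g. c \<le> blinfun_apply g y}" using Pair by auto
    moreover have "convex {g::'a \<Rightarrow>\<^sub>L real. c \<le> blinfun_apply g y}"
    proof (rule convexI, simp add: blinfun.add_left blinfun.scaleR_left)
      fix g h :: "'a \<Rightarrow>\<^sub>L real" and u v :: real
      assume *: "c \<le> blinfun_apply g y" "c \<le> blinfun_apply h y" "0 \<le> u" "0 \<le> v" "u + v = 1"
      have "c = u * c + v * c" using * by (simp flip: distrib_right)
      also have "\<dots> \<le> u * blinfun_apply g y + v * blinfun_apply h y"
        using * by (intro add_mono mult_left_mono) auto
      finally show "c \<le> u * blinfun_apply g y + v * blinfun_apply h y" .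
    qed
    ultimately show ?thesis
      using Pair wstar_compact_slice[OF wstar_compact_dual_ball, of c y] by (simp add: convex_Int)
  qed
  then have "wstar_compact ?Q"
    using I(2) by (intro wstar_compact_convex_hull_Union) auto
  moreover have sub: "T \<subseteq> \<Union>(?H ` I)"
  proof
    fix g assume "g \<in> T"
    then obtain y c where "(y, c) \<in> I" "c < blinfun_apply g y" using I(3) by fastforce
    then show "g \<in> \<Union>(?H ` I)" using T(3) \<open>g \<in> T\<close> by (intro UN_I[of "(y, c)"]) auto
  qed
  then have "T \<subseteq> ?Q" using hull_subset by (rule order_trans)
  then have "norming ?Q" using T(2) unfolding norming_def by blast
  ultimately have "cball 0 1 \<subseteq> ?Q"
    by (intro norming_convex_contains_dual_ball) auto
  moreover have "?Q \<subseteq> cball 0 1" by (intro hull_minimal) auto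
  ultimately have "?Q = cball 0 1" by simp
  then have "f extreme_point_of ?Q" using f(1) by (simp add: ext_dual_def)
  then have "f \<in> \<Union>(?H ` I)" by (rule extreme_point_of_convex_hull)
  then show False using I(1) by force
qed

section \<open>Gateaux derivatives of the norm and ball hulls\<close>

text \<open>The one-sided directional derivative of the norm at \<open>c\<close>. Difference quotients of a convex function
decrease with the step, so the limit at \<open>0\<close> is an infimum.\<close>

definition norm_rderiv :: "'a::real_normed_vector \<Rightarrow> 'a \<Rightarrow> real" where
  "norm_rderiv c z = (INF t\<in>{0<..}. (norm (c + t *\<^sub>R z) - norm c) / t)"

lemma norm_slope_bounds:
  assumes "t > 0"
  shows "- norm z \<le> (norm (c + t *\<^sub>R z) - norm c) / t" "(norm (c + t *\<^sub>R z) - norm c) / t \<le> norm z"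
proof -
  have "norm c - t * norm z \<le> norm (c + t *\<^sub>R z)" "norm (c + t *\<^sub>R z) \<le> norm c + t * norm z"
    using norm_diff_ineq[of c "t *\<^sub>R z"] norm_triangle_ineq[of c "t *\<^sub>R z"] assms by auto
  then show "- norm z \<le> (norm (c + t *\<^sub>R z) - norm c) / t" "(norm (c + t *\<^sub>R z) - norm c) / t \<le> norm z"
    using assms by (auto simp: field_simps)
qed

lemma norm_slope_mono:
  assumes "0 < s" "s \<le> t"
  shows "(norm (c + s *\<^sub>R z) - norm c) / s \<le> (norm (c + t *\<^sub>R z) - norm c) / t"
proof -
  have "t *\<^sub>R (c + s *\<^sub>R z) = (t - s) *\<^sub>R c + s *\<^sub>R (c + t *\<^sub>R z)"
    by (simp add: algebra_simps)
  then have "norm (t *\<^sub>R (c + s *\<^sub>R z)) \<le> norm ((t - s) *\<^sub>R c) + norm (s *\<^sub>R (c + t *\<^sub>R z))"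
    by (metis norm_triangle_ineq)
  then have "t * norm (c + s *\<^sub>R z) \<le> (t - s) * norm c + s * norm (c + t *\<^sub>R z)"
    using assms by (simp only: norm_scaleR)
  then show ?thesis using assms by (simp add: field_simps)
qed

lemma bdd_below_norm_slopes: "bdd_below ((\<lambda>t. (norm (c + t *\<^sub>R z) - norm c) / t) ` {0<..})"
  using norm_slope_bounds(1)[of _ z c] by (intro bdd_belowI2[of _ "- norm z"]) auto

lemma norm_rderiv_le_slope: "t > 0 \<Longrightarrow> norm_rderiv c z \<le> (norm (c + t *\<^sub>R z) - norm c) / t"
  unfolding norm_rderiv_def by (rule cINF_lower[OF bdd_below_norm_slopes]) simp

lemma norm_slope_lt_eventually:
  assumes "norm_rderiv c z < a"
  obtains t0 where "t0 > 0" "\<And>t. 0 < t \<Longrightarrow> t \<le> t0 \<Longrightarrow> (norm (c + t *\<^sub>R z) - norm c) / t < a"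
proof -
  obtain t0 where "t0 > 0" "(norm (c + t0 *\<^sub>R z) - norm c) / t0 < a"
    using assms unfolding norm_rderiv_def
    by (subst (asm) cINF_less_iff[OF _ bdd_below_norm_slopes]) auto
  then show ?thesis using norm_slope_mono[of _ t0 c z] that by (meson order_le_less_trans)
qed

lemma norm_rderiv_le_norm: "norm_rderiv c z \<le> norm z"
  using norm_rderiv_le_slope[of 1 c z] norm_slope_bounds(2)[of 1 c z] by linarith

lemma norm_rderiv_ge: "- norm z \<le> norm_rderiv c z"
  unfolding norm_rderiv_def using norm_slope_bounds(1)[of _ z c] by (intro cINF_greatest) auto

lemma norm_rderiv_self: "norm_rderiv c c = norm c"
proof -
  have *: "(norm (c + t *\<^sub>R c) - norm c) / t = norm c" if "t > 0" for t :: real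
  proof -
    have "c + t *\<^sub>R c = (1 + t) *\<^sub>R c" by (simp add: algebra_simps)
    then have "norm (c + t *\<^sub>R c) = (1 + t) * norm c" using that by simp
    then show ?thesis using that by (simp add: field_simps)
  qed
  have "norm_rderiv c c = (INF t\<in>{0::real<..}. norm c)"
    unfolding norm_rderiv_def by (rule arg_cong[of _ _ Inf], rule image_cong[OF refl]) (use * in auto)
  then show ?thesis by simp
qed

lemma norm_rderiv_add_le: "norm_rderiv c (x + y) \<le> norm_rderiv c x + norm_rderiv c y"
proof (rule field_le_epsilon)
  fix e :: real assume "e > 0"
  obtain s where s: "s > 0" "\<And>t. 0 < t \<Longrightarrow> t \<le> s \<Longrightarrow> (norm (c + t *\<^sub>R x) - norm c) / t < norm_rderiv c x + e / 2"
    using norm_slope_lt_eventually[of c x "norm_rderiv c x + e / 2"] \<open>e > 0\<close> by auto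
  obtain r where r: "r > 0" "\<And>t. 0 < t \<Longrightarrow> t \<le> r \<Longrightarrow> (norm (c + t *\<^sub>R y) - norm c) / t < norm_rderiv c y + e / 2"
    using norm_slope_lt_eventually[of c y "norm_rderiv c y + e / 2"] \<open>e > 0\<close> by auto
  define t where "t = min s r"
  have t: "t > 0" "t \<le> s" "t \<le> r" using s(1) r(1) by (auto simp: t_def)
  \<comment> \<open>Convexity: the point reached along \<open>x + y\<close> with half the step is a midpoint.\<close>
  have "2 *\<^sub>R (c + (t / 2) *\<^sub>R (x + y)) = (c + t *\<^sub>R x) + (c + t *\<^sub>R y)"
    by (simp add: algebra_simps scaleR_2)
  then have "2 * norm (c + (t / 2) *\<^sub>R (x + y)) \<le> norm (c + t *\<^sub>R x) + norm (c + t *\<^sub>R y)"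
    using norm_triangle_ineq[of "c + t *\<^sub>R x" "c + t *\<^sub>R y"] norm_scaleR[of 2 "c + (t / 2) *\<^sub>R (x + y)"] by simp
  then have "(2 * norm (c + (t / 2) *\<^sub>R (x + y)) - 2 * norm c) / t \<le>
      (norm (c + t *\<^sub>R x) + norm (c + t *\<^sub>R y) - 2 * norm c) / t"
    using t by (intro divide_right_mono) auto
  then have "(norm (c + (t / 2) *\<^sub>R (x + y)) - norm c) / (t / 2) \<le>
      (norm (c + t *\<^sub>R x) - norm c) / t + (norm (c + t *\<^sub>R y) - norm c) / t"
    by (simp add: diff_divide_distrib add_divide_distrib mult.commute)
  then show "norm_rderiv c (x + y) \<le> norm_rderiv c x + norm_rderiv c y + e"
    using norm_rderiv_le_slope[of "t / 2" c "x + y"] s(2)[of t] r(2)[of t] t by simp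
qed

lemma norm_rderiv_scale_le:
  assumes "a > 0"
  shows "norm_rderiv c (a *\<^sub>R z) \<le> a * norm_rderiv c z"
proof -
  have "norm_rderiv c (a *\<^sub>R z) / a \<le> norm_rderiv c z"
    unfolding norm_rderiv_def[of c z]
  proof (rule cINF_greatest)
    fix t :: real assume "t \<in> {0<..}"
    then show "norm_rderiv c (a *\<^sub>R z) / a \<le> (norm (c + t *\<^sub>R z) - norm c) / t"
      using norm_rderiv_le_slope[of "t / a" c "a *\<^sub>R z"] assms by (simp add: field_simps)
  qed simp
  then show ?thesis using assms by (simp add: field_simps)
qed

lemma norm_rderiv_scale:
  assumes "a > 0"
  shows "norm_rderiv c (a *\<^sub>R z) = a * norm_rderiv c z"
proof (rule antisym)
  show "a * norm_rderiv c z \<le> norm_rderiv c (a *\<^sub>R z)"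
    using norm_rderiv_scale_le[of "1 / a" c "a *\<^sub>R z"] assms by (simp add: field_simps)
qed (rule norm_rderiv_scale_le[OF assms])

lemma norm_rderiv_uminus_left: "norm_rderiv (- c) z = norm_rderiv c (- z)"
proof -
  have "norm (- c + t *\<^sub>R z) = norm (c + t *\<^sub>R (- z))" for t
    using norm_minus_cancel[of "- c + t *\<^sub>R z"] by simp
  then show ?thesis by (simp add: norm_rderiv_def)
qed

definition smooth_point :: "'a::real_normed_vector \<Rightarrow> bool" where
  "smooth_point c \<longleftrightarrow> (\<forall>z. norm_rderiv c (- z) = - norm_rderiv c z)"

text \<open>Subadditivity and the bound by the norm make the derivative Lipschitz in its direction, so a dense
set of directions suffices.\<close>

lemma smooth_pointI_dense:
  assumes D: "closure D = UNIV"
    and le: "\<And>d. d \<in> D \<Longrightarrow> norm_rderiv c d + norm_rderiv c (- d) \<le> 0"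
  shows "smooth_point c"
  unfolding smooth_point_def
proof
  fix z
  have "norm_rderiv c z + norm_rderiv c (- z) \<le> 0"
  proof (rule field_le_epsilon)
    fix e :: real assume "e > 0"
    then obtain d where d: "d \<in> D" "dist d z < e / 2"
      using D closure_approachable[of z D] by (metis UNIV_I half_gt_zero)
    have "norm_rderiv c z \<le> norm_rderiv c d + norm_rderiv c (z - d)"
      using norm_rderiv_add_le[of c d "z - d"] by simp
    moreover have "norm_rderiv c (- z) \<le> norm_rderiv c (- d) + norm_rderiv c (d - z)"
      using norm_rderiv_add_le[of c "- d" "d - z"] by simp
    ultimately show "norm_rderiv c z + norm_rderiv c (- z) \<le> 0 + e"
      using le[OF d(1)] d(2) norm_rderiv_le_norm[of c "z - d"] norm_rderiv_le_norm[of c "d - z"]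
      by (simp add: dist_norm norm_minus_commute)
  qed
  moreover have "0 \<le> norm_rderiv c z + norm_rderiv c (- z)"
    using norm_rderiv_add_le[of c z "- z"] norm_rderiv_ge[of 0 c] by simp
  ultimately show "norm_rderiv c (- z) = - norm_rderiv c z" by simp
qed

lemma smooth_point_linear:
  assumes "smooth_point c"
  shows "linear (norm_rderiv c)"
proof (rule linearI)
  have m: "norm_rderiv c (- z) = - norm_rderiv c z" for z
    using assms by (simp add: smooth_point_def)
  fix x y
  have "norm_rderiv c x \<le> norm_rderiv c (x + y) - norm_rderiv c y"
    using norm_rderiv_add_le[of c "x + y" "- y"] m by simp
  then show "norm_rderiv c (x + y) = norm_rderiv c x + norm_rderiv c y"
    using norm_rderiv_add_le[of c x y] by simp
  fix a :: real
  consider "a > 0" | "a = 0" | "a < 0" by linarith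
  then show "norm_rderiv c (a *\<^sub>R x) = a *\<^sub>R norm_rderiv c x"
  proof cases
    case 1
    then show ?thesis by (simp add: norm_rderiv_scale)
  next
    case 2
    then show ?thesis using m[of 0] by simp
  next
    case 3
    then show ?thesis using norm_rderiv_scale[of "- a" c x] m[of "a *\<^sub>R x"] by simp
  qed
qed

text \<open>If both directional derivatives at \<open>c\<close> are below \<open>a\<close>, then for all small \<open>t\<close> the ball of
radius \<open>norm c / t + a\<close> around \<open>- c / t\<close> contains \<open>x\<close> and \<open>y\<close>, hence the hull; and the
difference quotient at any point of this ball is at most \<open>a\<close>.\<close>

lemma norm_rderiv_m_hull_le:
  assumes z: "z \<in> m_hull {x, y}"
  shows "norm_rderiv c z \<le> max (norm_rderiv c x) (norm_rderiv c y)"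
proof (rule dense_le)
  fix a' assume a': "a' < norm_rderiv c z"
  show "a' \<le> max (norm_rderiv c x) (norm_rderiv c y)"
  proof (rule ccontr)
    assume "\<not> ?thesis"
    then have *: "norm_rderiv c x < a'" "norm_rderiv c y < a'" by auto
    obtain s where s: "s > 0" "\<And>t. 0 < t \<Longrightarrow> t \<le> s \<Longrightarrow> (norm (c + t *\<^sub>R x) - norm c) / t < a'"
      using norm_slope_lt_eventually[OF *(1)] by auto
    obtain r where r: "r > 0" "\<And>t. 0 < t \<Longrightarrow> t \<le> r \<Longrightarrow> (norm (c + t *\<^sub>R y) - norm c) / t < a'"
      using norm_slope_lt_eventually[OF *(2)] by auto
    define t where "t = min s r"
    have t: "t > 0" "t \<le> s" "t \<le> r" using s(1) r(1) by (auto simp: t_def)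
    let ?B = "cball (- (1 / t) *\<^sub>R c) (norm c / t + a')"
    have ball: "w \<in> ?B \<longleftrightarrow> (norm (c + t *\<^sub>R w) - norm c) / t \<le> a'" for w
    proof -
      have "c + t *\<^sub>R w = - t *\<^sub>R (- (1 / t) *\<^sub>R c - w)" using t by (simp add: algebra_simps)
      then have "norm (c + t *\<^sub>R w) = t * dist (- (1 / t) *\<^sub>R c) w"
        using t(1) by (simp only: norm_scaleR dist_norm)
      then show ?thesis using t by (simp add: field_simps)
    qed
    have "{x, y} \<subseteq> ?B" using ball s(2)[of t] r(2)[of t] t by auto
    then have "m_hull {x, y} \<subseteq> ?B" unfolding m_hull_def by blast
    then have "(norm (c + t *\<^sub>R z) - norm c) / t \<le> a'" using z ball by blast
    then show False using a' norm_rderiv_le_slope[OF t(1), of c z] by simp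
  qed
qed

text \<open>On a segment in direction \<open>d\<close> that avoids the set, the slope of the norm grows by at least \<open>m\<close>
at every step of a subdivision, whatever its mesh. The slope lies between \<open>- norm d\<close> and
\<open>norm d\<close>, so a subdivision with more than \<open>2 * norm d / m\<close> steps is impossible.\<close>

lemma small_second_difference_dense:
  fixes d :: "'a::real_normed_vector"
  assumes m: "m > 0"
  shows "closure {c. \<exists>t>0. norm (c + t *\<^sub>R d) + norm (c - t *\<^sub>R d) - 2 * norm c < t * m} = UNIV"
    (is "closure ?O = UNIV")
proof (rule ccontr)
  assume "closure ?O \<noteq> UNIV"
  then obtain c e where e: "e > 0" and far: "\<And>y. y \<in> ?O \<Longrightarrow> e \<le> dist y c"
    using closure_approachable[of _ ?O] by (metis (no_types, lifting) UNIV_eq_I linorder_not_less)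
  define s0 where "s0 = e / (2 * (norm d + 1))"
  have s0: "s0 > 0" using e by (simp add: s0_def add_nonneg_pos)
  have s0d: "s * norm d < e" if "0 \<le> s" "s \<le> s0" for s
  proof -
    have "s * norm d \<le> s0 * (norm d + 1)" using that by (intro mult_mono) auto
    also have "\<dots> = e / 2" unfolding s0_def using norm_ge_zero[of d]
      by (simp add: field_simps add_nonneg_eq_0_iff) 
    finally show ?thesis using e by simp
  qed
  define \<phi> where "\<phi> s = norm (c + s *\<^sub>R d)" for s
  have conv: "t * m \<le> \<phi> (s + t) + \<phi> (s - t) - 2 * \<phi> s" if "0 \<le> s" "s \<le> s0" "t > 0" for s t
  proof -
    have "dist (c + s *\<^sub>R d) c < e" using s0d[OF that(1,2)] that by (simp add: dist_norm)
    then have "c + s *\<^sub>R d \<notin> ?O" using far[of "c + s *\<^sub>R d"] by linarith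
    then have "t * m \<le> norm (c + s *\<^sub>R d + t *\<^sub>R d) + norm (c + s *\<^sub>R d - t *\<^sub>R d) - 2 * norm (c + s *\<^sub>R d)"
      using that(3) not_less by blast
    moreover have "c + (s + t) *\<^sub>R d = c + s *\<^sub>R d + t *\<^sub>R d" "c + (s - t) *\<^sub>R d = c + s *\<^sub>R d - t *\<^sub>R d"
      by (simp_all add: scaleR_add_left scaleR_diff_left)
    ultimately show ?thesis by (simp only: \<phi>_def)
  qed
  obtain N :: nat where N: "2 * norm d / m < N" using reals_Archimedean2 by blast
  have "N > 0" using N m norm_ge_zero[of d] by (cases N) (auto simp: field_simps)
  define h where "h = s0 / N"
  have h: "h > 0" using s0 \<open>N > 0\<close> by (simp add: h_def)
  have lip: "\<bar>\<phi> (s + h) - \<phi> s\<bar> \<le> h * norm d" for s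
    unfolding \<phi>_def using norm_triangle_ineq3[of "c + (s + h) *\<^sub>R d" "c + s *\<^sub>R d"] h
    by (simp add: algebra_simps)
  \<comment> \<open>The increments over steps of length \<open>h\<close> grow by at least \<open>h * m\<close> each time.\<close>
  have "- h * norm d + i * (h * m) \<le> \<phi> (i * h + h) - \<phi> (i * h)" if "i \<le> N" for i :: nat
    using that
  proof (induction i)
    case 0
    then show ?case using lip[of 0] by simp
  next
    case (Suc i)
    have "real (Suc i) * h \<le> N * h" using Suc.prems h by (intro mult_right_mono) auto
    then have "Suc i * h \<le> s0" using \<open>N > 0\<close> by (simp add: h_def)
    then have "h * m \<le> \<phi> (Suc i * h + h) + \<phi> (Suc i * h - h) - 2 * \<phi> (Suc i * h)"
      using conv[of "Suc i * h" h] h by simp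
    moreover have "Suc i * h - h = i * h" "i * h + h = Suc i * h" by (simp_all add: algebra_simps)
    ultimately show ?case using Suc by (simp add: algebra_simps)
  qed
  from this[of N] lip[of "N * h"] have "- h * norm d + N * (h * m) \<le> h * norm d" by simp
  then have "h * (N * m) \<le> h * (2 * norm d)" by (simp add: algebra_simps)
  then have "N * m \<le> 2 * norm d" using h by simp
  then show False using N m by (simp add: field_simps)
qed

text \<open>Mazur's theorem. For a direction \<open>d\<close>, differentiability of the norm at \<open>c\<close> means that the second
difference quotient gets arbitrarily small, which for each bound \<open>1 / Suc n\<close> is an open dense
condition on \<open>c\<close>. Only countably many pairs \<open>d\<close>, \<open>n\<close> are needed, and Baire's theorem applies.\<close>

lemma smooth_points_dense:
  assumes "separable_space (euclidean :: 'a::banach topology)"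
  shows "closure {c::'a. smooth_point c} = UNIV"
proof -
  obtain D :: "'a set" where D: "countable D" "closure D = UNIV"
    using assms unfolding separable_space_def by auto
  let ?O = "\<lambda>(d::'a, n::nat). {c. \<exists>t>0. norm (c + t *\<^sub>R d) + norm (c - t *\<^sub>R d) - 2 * norm c < t * (1 / Suc n)}"
  let ?G = "?O ` (D \<times> UNIV)"
  have "euclidean closure_of (\<Inter>?G) = topspace (euclidean :: 'a topology)"
  proof (rule Baire_category)
    show "completely_metrizable_space (euclidean :: 'a topology) \<or>
        locally_compact_space (euclidean :: 'a topology) \<and> regular_space (euclidean :: 'a topology)"
      using completely_metrizable_space_euclidean by blast
    show "countable ?G" using D(1) by (intro countable_image countable_SIGMA) auto
    fix T assume "T \<in> ?G"
    then obtain d n where T: "T = ?O (d, n)" by blast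
    have "T = (\<Union>t\<in>{0<..}. {c. norm (c + t *\<^sub>R d) + norm (c - t *\<^sub>R d) - 2 * norm c < t * (1 / Suc n)})"
      unfolding T by auto
    also have "open \<dots>"
      by (intro open_UN ballI open_Collect_less continuous_intros)
    finally show "openin euclidean T \<and> euclidean closure_of T = topspace (euclidean :: 'a topology)"
      using small_second_difference_dense[of "1 / Suc n" d] unfolding T by simp
  qed
  then have "closure (\<Inter>?G) = UNIV" by simp
  moreover have "\<Inter>?G \<subseteq> {c. smooth_point c}"
  proof (intro subsetI CollectI)
    fix c assume c: "c \<in> \<Inter>?G"
    show "smooth_point c"
    proof (rule smooth_pointI_dense[OF D(2)])
      fix d assume "d \<in> D"
      have "norm_rderiv c d + norm_rderiv c (- d) < 1 / Suc n" for n
      proof -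
        have "c \<in> ?O (d, n)" using c \<open>d \<in> D\<close> by blast
        then obtain t where t: "t > 0" "norm (c + t *\<^sub>R d) + norm (c - t *\<^sub>R d) - 2 * norm c < t * (1 / Suc n)"
          by auto
        have "norm_rderiv c d + norm_rderiv c (- d) \<le>
            (norm (c + t *\<^sub>R d) - norm c) / t + (norm (c + t *\<^sub>R (- d)) - norm c) / t"
          by (intro add_mono norm_rderiv_le_slope t)
        also have "\<dots> = (norm (c + t *\<^sub>R d) + norm (c - t *\<^sub>R d) - 2 * norm c) / t"
          by (simp add: add_divide_distrib diff_divide_distrib)
        also have "\<dots> < 1 / Suc n" using t by (simp add: field_simps)
        finally show ?thesis .
      qed
      then show "norm_rderiv c d + norm_rderiv c (- d) \<le> 0"
        by (meson nat_approx_posE not_less order_less_asym)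
    qed
  qed
  ultimately show ?thesis using closure_mono by blast
qed

text \<open>The derivative at \<open>b\<close> takes the value \<open>norm b\<close> at \<open>b\<close> and is 1-Lipschitz, so the derivatives at a
dense set of points are norming. The lower bound on the hull is the upper bound for the
derivative at \<open>- b\<close>, which is the negative of the one at \<open>b\<close>.\<close>

lemma countable_norming_hull_functionals:
  assumes "separable_space (euclidean :: 'a::banach topology)"
  obtains E :: "('a::banach \<Rightarrow>\<^sub>L real) set" where "countable E" "E \<subseteq> cball 0 1" "norming E"
    "\<And>f x y z. f \<in> E \<Longrightarrow> z \<in> m_hull {x, y} \<Longrightarrow>
      blinfun_apply f z \<in> {min (blinfun_apply f x) (blinfun_apply f y)..max (blinfun_apply f x) (blinfun_apply f y)}"
proof -
  obtain D :: "'a set" where D: "countable D" "closure D = UNIV"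
    using assms unfolding separable_space_def by auto
  define c where "c d n = (SOME c. smooth_point c \<and> dist c d < 1 / Suc n)" for d :: 'a and n :: nat
  have "\<exists>c. smooth_point c \<and> dist c d < 1 / Suc n" for d :: 'a and n :: nat
    using smooth_points_dense[OF assms] closure_approachable[of d "{c. smooth_point c}"]
    by (metis UNIV_I mem_Collect_eq of_nat_0_less_iff zero_less_Suc zero_less_divide_1_iff)
  then have c: "smooth_point (c d n)" "dist (c d n) d < 1 / Suc n" for d n
    using someI_ex unfolding c_def by (metis (mono_tags, lifting))+
  have Bf: "Blinfun (norm_rderiv b) \<in> cball 0 1 \<and> blinfun_apply (Blinfun (norm_rderiv b)) = norm_rderiv b"
    if "smooth_point b" for b :: 'a
  proof -
    have "\<forall>x. \<bar>norm_rderiv b x\<bar> \<le> norm x"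
      using norm_rderiv_le_norm[of b] norm_rderiv_ge[of _ b] by (auto simp: abs_le_iff minus_le_iff)
    then have "norm_rderiv b \<in> blinfun_apply ` cball 0 1"
      unfolding image_blinfun_apply_cball using smooth_point_linear[OF that] by simp
    then show ?thesis by (auto simp: blinfun_apply_inverse)
  qed
  define f where "f d n = Blinfun (norm_rderiv (c d n))" for d n
  have f: "f d n \<in> cball 0 1" "blinfun_apply (f d n) = norm_rderiv (c d n)" for d n
    using Bf[OF c(1)] by (simp_all add: f_def)
  define E where "E = (\<lambda>(d, n). f d n) ` (D \<times> UNIV)"
  show ?thesis
  proof (rule that)
    show "countable E" unfolding E_def using D(1) by (intro countable_image countable_SIGMA) auto
    show "E \<subseteq> cball 0 1" using f(1) by (auto simp: E_def)
    show "norming E"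
      unfolding norming_def
    proof (intro allI impI)
      fix x :: 'a and e :: real assume "e > 0"
      obtain d where d: "d \<in> D" "dist d x < e / 4"
        using D closure_approachable[of x D] \<open>e > 0\<close> by (metis UNIV_I zero_less_divide_iff zero_less_numeral)
      obtain n :: nat where n: "1 / Suc n < e / 4"
        using nat_approx_posE[of "e / 4"] \<open>e > 0\<close> by auto
      let ?c = "c d n"
      have dist: "norm (?c - x) < e / 2"
        using dist_triangle[of ?c x d] c(2)[of d n] d(2) n by (simp add: dist_norm)
      have "norm ?c \<le> norm_rderiv ?c x + norm_rderiv ?c (?c - x)"
        using norm_rderiv_add_le[of ?c x "?c - x"] norm_rderiv_self[of ?c] by simp
      then have "norm x - e \<le> norm_rderiv ?c x"
        using dist norm_rderiv_le_norm[of ?c "?c - x"] norm_triangle_ineq2[of x ?c]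
        by (simp add: norm_minus_commute)
      then show "\<exists>f\<in>E. norm x - e \<le> blinfun_apply f x"
        using d(1) by (intro bexI[of _ "f d n"]) (auto simp: f(2) E_def)
    qed
    fix g and x y z :: 'a assume "g \<in> E" and z: "z \<in> m_hull {x, y}"
    then obtain d n where "g = f d n" by (auto simp: E_def)
    then obtain b where b: "smooth_point b" "blinfun_apply g = norm_rderiv b"
      using c(1) f(2) by blast
    have "norm_rderiv (- b) w = - norm_rderiv b w" for w
      using b(1) by (simp add: norm_rderiv_uminus_left smooth_point_def)
    then show "blinfun_apply g z \<in> {min (blinfun_apply g x) (blinfun_apply g y)..max (blinfun_apply g x) (blinfun_apply g y)}"
      using norm_rderiv_m_hull_le[OF z, of b] norm_rderiv_m_hull_le[OF z, of "- b"] b(2) by auto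
  qed
qed

section \<open>The weak topology\<close>

lemma norming_separates:
  assumes "norming T" "\<And>f. f \<in> T \<Longrightarrow> blinfun_apply f u = blinfun_apply f v"
  shows "u = v"
proof -
  have "norm (u - v) \<le> 0"
    by (rule norming_bound_imp_norm_le[OF assms(1)]) (simp add: blinfun.diff_right assms(2))
  then show ?thesis by simp
qed

lemma continuous_map_weak_topology:
  fixes f :: "'a::real_normed_vector \<Rightarrow>\<^sub>L real"
  shows "continuous_map weak_topology euclidean (blinfun_apply f)"
  unfolding continuous_map_def
proof (intro conjI allI impI)
  fix U :: "real set" assume "openin euclidean U"
  then have "openin weak_topology (blinfun_apply f -` U)"
    unfolding weak_topology_def by (intro topology_generated_by_Basis) auto
  then show "openin weak_topology {x \<in> topspace weak_topology. blinfun_apply f x \<in> U}"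
    by (simp add: vimage_def)
qed simp

lemma closedin_weak_preimage:
  fixes f :: "'a::real_normed_vector \<Rightarrow>\<^sub>L real"
  assumes "closed B"
  shows "closedin weak_topology {x. blinfun_apply f x \<in> B}"
  using closedin_continuous_map_preimage[OF continuous_map_weak_topology, of B f] assms by simp

lemma continuous_map_norm_weak: "continuous_map euclidean weak_topology (\<lambda>x. x)"
  unfolding weak_topology_def
proof (rule continuous_on_generated_topo)
  fix U :: "'a set" assume "U \<in> {blinfun_apply f -` U | (f :: 'a \<Rightarrow>\<^sub>L real) U. open U}"
  then obtain f :: "'a \<Rightarrow>\<^sub>L real" and V where "U = blinfun_apply f -` V" "open V" by blast
  then show "openin euclidean ((\<lambda>x. x) -` U \<inter> topspace euclidean)"
    by (auto intro!: open_vimage continuous_intros)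
next
  show "(\<lambda>x. x) ` topspace euclidean \<subseteq> \<Union> {blinfun_apply f -` U | (f :: 'a \<Rightarrow>\<^sub>L real) U. open U}"
    using topspace_weak_topology[where 'a = 'a] by (simp add: weak_topology_def)
qed

lemma Hausdorff_weak_topology:
  fixes T :: "('a::real_normed_vector \<Rightarrow>\<^sub>L real) set"
  assumes "norming T"
  shows "Hausdorff_space (weak_topology :: 'a topology)"
  unfolding Hausdorff_space_def
proof (intro allI impI, elim conjE)
  fix x y :: 'a assume "x \<noteq> y"
  have "\<exists>f\<in>T. blinfun_apply f x \<noteq> blinfun_apply f y"
    by (rule ccontr) (use norming_separates[OF assms, of x y] \<open>x \<noteq> y\<close> in auto)
  then obtain f :: "'a \<Rightarrow>\<^sub>L real" where f: "blinfun_apply f x \<noteq> blinfun_apply f y" by blast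
  then obtain U V where "open U" "open V" "blinfun_apply f x \<in> U" "blinfun_apply f y \<in> V" "U \<inter> V = {}"
    using hausdorff[OF f] by blast
  moreover have "openin weak_topology {z. blinfun_apply f z \<in> W}" if "open W" for W
    using openin_continuous_map_preimage[OF continuous_map_weak_topology, of W f] that by simp
  ultimately show "\<exists>U V. openin weak_topology U \<and> openin weak_topology V \<and> x \<in> U \<and> y \<in> V \<and> disjnt U V"
    by (intro exI[of _ "{z. blinfun_apply f z \<in> U}"] exI[of _ "{z. blinfun_apply f z \<in> V}"])
       (auto simp: disjnt_def)
qed

text \<open>Weakly compact sets are weakly closed because a norming set makes the weak topology Hausdorff, and
a convergent sequence stays in a ball.\<close>

lemma boundedly_weakly_compact_imp_closed:
  fixes M :: "'a::real_normed_vector set"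
  assumes M: "boundedly_weakly_compact M" and T: "norming (T :: ('a \<Rightarrow>\<^sub>L real) set)"
  shows "closed M"
  unfolding closed_sequential_limits
proof (intro allI impI, elim conjE)
  fix u l assume u: "\<forall>n. u n \<in> M" "u \<longlonglongrightarrow> l"
  then have "bounded (range u)" by (intro convergent_imp_bounded)
  then obtain r where r: "\<And>n. u n \<in> cball 0 r"
    unfolding bounded_iff by auto
  have "closedin weak_topology (M \<inter> cball 0 r)"
    using M compactin_imp_closedin[OF Hausdorff_weak_topology[OF T]]
    unfolding boundedly_weakly_compact_def by blast
  from closedin_continuous_map_preimage[OF continuous_map_norm_weak this]
  have "closed (M \<inter> cball 0 r)" by (simp add: Int_def)
  then have "l \<in> M \<inter> cball 0 r"
    by (rule closed_sequentially[OF _ _ u(2)]) (use u(1) r in blast)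
  then show "l \<in> M" by simp
qed

section \<open>Arcs of maximal chains\<close>

definition fun_le :: "(nat \<Rightarrow> 'a::real_normed_vector \<Rightarrow>\<^sub>L real) \<Rightarrow> 'a \<Rightarrow> 'a \<Rightarrow> bool" where
  "fun_le g u v \<longleftrightarrow> (\<forall>n. blinfun_apply (g n) u \<le> blinfun_apply (g n) v)"

lemma fun_le_refl [simp]: "fun_le g u u"
  by (simp add: fun_le_def)

lemma fun_le_trans: "fun_le g u v \<Longrightarrow> fun_le g v w \<Longrightarrow> fun_le g u w"
  unfolding fun_le_def by (meson order_trans)

lemma closedin_fun_le:
  "closedin weak_topology {z. fun_le g c z}" "closedin weak_topology {z. fun_le g z c}"
proof -
  have "{z. fun_le g c z} = (\<Inter>n. {z. blinfun_apply (g n) z \<in> {blinfun_apply (g n) c..}})"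
       "{z. fun_le g z c} = (\<Inter>n. {z. blinfun_apply (g n) z \<in> {..blinfun_apply (g n) c}})"
    by (auto simp: fun_le_def)
  then show "closedin weak_topology {z. fun_le g c z}" "closedin weak_topology {z. fun_le g z c}"
    by (simp_all only:) (intro closedin_INT closedin_weak_preimage; simp)+
qed

text \<open>Summing the functionals with weights \<open>(1 / 2) ^ n\<close> gives a functional that increases strictly along
the order, because the value at \<open>v - u\<close> is a sum of nonnegative terms.\<close>

lemma strictly_increasing_functional:
  fixes g :: "nat \<Rightarrow> 'a::real_normed_vector \<Rightarrow>\<^sub>L real"
  assumes bound: "\<And>n. g n \<in> cball 0 1"
    and sep: "\<And>u v. \<forall>n. blinfun_apply (g n) u = blinfun_apply (g n) v \<Longrightarrow> u = v"
  obtains \<phi> :: "'a \<Rightarrow>\<^sub>L real" where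
    "\<And>u v. fun_le g u v \<Longrightarrow> u \<noteq> v \<Longrightarrow> blinfun_apply \<phi> u < blinfun_apply \<phi> v"
proof -
  define h where "h n = (1 / 2) ^ n *\<^sub>R g n" for n
  have summ: "summable h"
  proof (rule summable_comparison_test)
    have "norm (h n) \<le> (1 / 2) ^ n" for n
      using mult_left_mono[of "norm (g n)" 1 "(1 / 2) ^ n"] bound[of n] by (simp add: h_def)
    then show "\<exists>N. \<forall>n\<ge>N. norm (h n) \<le> (1 / 2) ^ n" by blast
    show "summable (\<lambda>n. (1 / 2) ^ n :: real)" by (simp add: summable_geometric)
  qed
  define \<phi> where "\<phi> = suminf h"
  have ev: "bounded_linear (\<lambda>f::'a \<Rightarrow>\<^sub>L real. blinfun_apply f z)" for z
    by (rule blinfun.bounded_linear_left)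
  have \<phi>: "blinfun_apply \<phi> z = (\<Sum>n. (1 / 2) ^ n * blinfun_apply (g n) z)"
    and \<phi>_summ: "summable (\<lambda>n. (1 / 2) ^ n * blinfun_apply (g n) z)" for z
    using bounded_linear.suminf[OF ev summ, of z] bounded_linear.summable[OF ev summ, of z]
    by (simp_all only: \<phi>_def[symmetric]) (simp_all add: h_def blinfun.scaleR_left)
  show ?thesis
  proof (rule that)
    fix u v assume le: "fun_le g u v" and "u \<noteq> v"
    have nonneg: "0 \<le> (1 / 2) ^ n * blinfun_apply (g n) (v - u)" for n
      using le by (simp add: fun_le_def blinfun.diff_right)
    then have "0 \<le> blinfun_apply \<phi> (v - u)"
      unfolding \<phi> by (intro suminf_nonneg \<phi>_summ)
    moreover have "blinfun_apply \<phi> (v - u) \<noteq> 0"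
    proof
      assume "blinfun_apply \<phi> (v - u) = 0"
      then have "\<forall>n. (1 / 2) ^ n * blinfun_apply (g n) (v - u) = 0"
        unfolding \<phi> using suminf_eq_zero_iff[OF \<phi>_summ[of "v - u"] nonneg] by simp
      then have "u = v" by (intro sep) (simp add: blinfun.diff_right)
      then show False using \<open>u \<noteq> v\<close> by simp
    qed
    ultimately show "blinfun_apply \<phi> u < blinfun_apply \<phi> v" by (simp add: blinfun.diff_right)
  qed
qed

text \<open>A maximal chain \<open>C\<close> consists of the points of \<open>S\<close> comparable with all of \<open>C\<close>, so it is weakly
closed in \<open>S\<close> and weakly compact. A gap in its image under the strictly increasing functional
would lie between the images of two elements of \<open>C\<close>, and a point of \<open>S\<close> between these could be
added to \<open>C\<close>. The inverse of a continuous injection of a compact set is continuous.\<close>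

lemma order_arc:
  fixes g :: "nat \<Rightarrow> 'a::real_normed_vector \<Rightarrow>\<^sub>L real"
  assumes bound: "\<And>n. g n \<in> cball 0 1"
    and sep: "\<And>u v. \<forall>n. blinfun_apply (g n) u = blinfun_apply (g n) v \<Longrightarrow> u = v"
    and S: "compactin weak_topology S"
    and xy: "x \<in> S" "y \<in> S" "\<And>z. z \<in> S \<Longrightarrow> fun_le g x z \<and> fun_le g z y"
    and dense: "\<And>u v. u \<in> S \<Longrightarrow> v \<in> S \<Longrightarrow> fun_le g u v \<Longrightarrow> u \<noteq> v \<Longrightarrow>
      \<exists>w\<in>S. w \<noteq> u \<and> w \<noteq> v \<and> fun_le g u w \<and> fun_le g w v"
  obtains k :: "real \<Rightarrow> 'a" where "k 0 = x" "k 1 = y" "k ` {0..1} \<subseteq> S"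
    "\<And>s t. 0 \<le> s \<Longrightarrow> s \<le> t \<Longrightarrow> t \<le> 1 \<Longrightarrow> fun_le g (k s) (k t)"
    "\<And>h::'a \<Rightarrow>\<^sub>L real. continuous_on {0..1} (\<lambda>t. blinfun_apply h (k t))"
proof -
  obtain \<phi> :: "'a \<Rightarrow>\<^sub>L real" where
    strict: "\<And>u v. fun_le g u v \<Longrightarrow> u \<noteq> v \<Longrightarrow> blinfun_apply \<phi> u < blinfun_apply \<phi> v"
    using strictly_increasing_functional[of g, OF bound sep] by blast
  have mono: "blinfun_apply \<phi> u \<le> blinfun_apply \<phi> v" if "fun_le g u v" for u v
    using strict[OF that] by (cases "u = v") auto
  obtain C where "pred_on.maxchain S (fun_le g) C"
    using pred_on.Hausdorff by blast
  moreover have chain: "pred_on.chain S (fun_le g) D \<longleftrightarrow> D \<subseteq> S \<and> (\<forall>u\<in>D. \<forall>v\<in>D. fun_le g u v \<or> fun_le g v u)" for D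
    unfolding pred_on.chain_def by (auto 4 3)
  ultimately have C: "C \<subseteq> S" "\<And>u v. u \<in> C \<Longrightarrow> v \<in> C \<Longrightarrow> fun_le g u v \<or> fun_le g v u"
    and nomore: "\<And>D. D \<subseteq> S \<Longrightarrow> (\<And>u v. u \<in> D \<Longrightarrow> v \<in> D \<Longrightarrow> fun_le g u v \<or> fun_le g v u) \<Longrightarrow> \<not> C \<subset> D"
    unfolding pred_on.maxchain_def chain by blast+
  have maximal: "z \<in> C" if "z \<in> S" "\<And>c. c \<in> C \<Longrightarrow> fun_le g z c \<or> fun_le g c z" for z
  proof -
    have "\<not> C \<subset> insert z C"
    proof (rule nomore)
      show "insert z C \<subseteq> S" using C(1) that(1) by blast
      fix u v assume "u \<in> insert z C" "v \<in> insert z C"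
      then show "fun_le g u v \<or> fun_le g v u"
        using C(2)[of u v] that(2)[of u] that(2)[of v] by (elim insertE) auto
    qed
    then show ?thesis by blast
  qed
  have "x \<in> C" "y \<in> C" using xy C(1) by (auto intro!: maximal)
  have order: "fun_le g u v" if "u \<in> C" "v \<in> C" "blinfun_apply \<phi> u \<le> blinfun_apply \<phi> v" for u v
    using C(2)[OF that(1,2)] strict[of v u] that(3) by (cases "u = v") auto
  have inj: "inj_on (blinfun_apply \<phi>) C"
    using C(2) strict by (intro inj_onI) (metis less_irrefl)

  have C_eq: "C = S \<inter> (\<Inter>c\<in>C. {z. fun_le g z c} \<union> {z. fun_le g c z})"
    using C maximal by auto
  have "closedin weak_topology (\<Inter>c\<in>C. {z. fun_le g z c} \<union> {z. fun_le g c z})"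
    using \<open>x \<in> C\<close> by (intro closedin_INT closedin_Un closedin_fun_le) auto
  then have Ccpt: "compactin weak_topology C"
    using compact_Int_closedin[OF S] C_eq by metis
  have img: "compact (blinfun_apply \<phi> ` {c\<in>C. blinfun_apply h c \<in> B})" if "closed B" for h :: "'a \<Rightarrow>\<^sub>L real" and B
  proof -
    have "compactin weak_topology (C \<inter> {c. blinfun_apply h c \<in> B})"
      using compact_Int_closedin[OF Ccpt closedin_weak_preimage[OF that]] .
    from image_compactin[OF this continuous_map_weak_topology[of \<phi>]]
    show ?thesis by (simp add: Collect_conj_eq)
  qed
  have cpt: "compact (blinfun_apply \<phi> ` C)" using img[of UNIV] by simp

  \<comment> \<open>No gaps: \<open>u\<close> and \<open>v\<close> are the last element of \<open>C\<close> below \<open>t\<close> and the first one above.\<close>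
  have range: "blinfun_apply \<phi> ` C = {blinfun_apply \<phi> x..blinfun_apply \<phi> y}"
  proof
    show "blinfun_apply \<phi> ` C \<subseteq> {blinfun_apply \<phi> x..blinfun_apply \<phi> y}"
      using C(1) xy(3) mono by auto
    show "{blinfun_apply \<phi> x..blinfun_apply \<phi> y} \<subseteq> blinfun_apply \<phi> ` C"
    proof (rule subsetI, rule ccontr)
      fix t assume t: "t \<in> {blinfun_apply \<phi> x..blinfun_apply \<phi> y}" "t \<notin> blinfun_apply \<phi> ` C"
      have "compact (blinfun_apply \<phi> ` C \<inter> {..t})" "compact (blinfun_apply \<phi> ` C \<inter> {t..})"
        using cpt by (auto intro: compact_Int_closed)
      note cpts = this
      have "blinfun_apply \<phi> x \<in> blinfun_apply \<phi> ` C \<inter> {..t}"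
        "blinfun_apply \<phi> y \<in> blinfun_apply \<phi> ` C \<inter> {t..}"
        using \<open>x \<in> C\<close> \<open>y \<in> C\<close> t(1) by auto
      then have ne: "blinfun_apply \<phi> ` C \<inter> {..t} \<noteq> {}" "blinfun_apply \<phi> ` C \<inter> {t..} \<noteq> {}" by blast+
      obtain a where a: "a \<in> blinfun_apply \<phi> ` C \<inter> {..t}" "\<forall>s\<in>blinfun_apply \<phi> ` C \<inter> {..t}. s \<le> a"
        using compact_attains_sup[OF cpts(1) ne(1)] by blast
      obtain b where b: "b \<in> blinfun_apply \<phi> ` C \<inter> {t..}" "\<forall>s\<in>blinfun_apply \<phi> ` C \<inter> {t..}. b \<le> s"
        using compact_attains_inf[OF cpts(2) ne(2)] by blast
      obtain u v where u: "u \<in> C" "a = blinfun_apply \<phi> u" and v: "v \<in> C" "b = blinfun_apply \<phi> v"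
        using a(1) b(1) by blast
      have "a < b" using a(1) b(1) t(2) by (metis IntE atLeast_iff atMost_iff order_le_less order_less_le_trans)
      then have "fun_le g u v" "u \<noteq> v" using order[OF u(1) v(1)] u v by auto
      then obtain w where w: "w \<in> S" "w \<noteq> u" "w \<noteq> v" "fun_le g u w" "fun_le g w v"
        using dense[of u v] u(1) v(1) C(1) by blast
      have "w \<in> C"
      proof (rule maximal[OF w(1)])
        fix c assume "c \<in> C"
        then have "blinfun_apply \<phi> c \<le> a \<or> b \<le> blinfun_apply \<phi> c"
          using a(2) b(2) by (metis Int_iff atLeast_iff atMost_iff imageI linear)
        then have "fun_le g c u \<or> fun_le g v c"
          using order \<open>c \<in> C\<close> u v by blast
        then show "fun_le g w c \<or> fun_le g c w"
          using w(4,5) fun_le_trans by blast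
      qed
      moreover have "a < blinfun_apply \<phi> w" "blinfun_apply \<phi> w < b"
        using strict w u(2) v(2) by auto
      ultimately show False
        using a(2) b(2) by (metis Int_iff atLeast_iff atMost_iff imageI linear not_less)
    qed
  qed

  define \<theta> where "\<theta> s = blinfun_apply \<phi> x + s * (blinfun_apply \<phi> y - blinfun_apply \<phi> x)" for s
  define k where "k s = inv_into C (blinfun_apply \<phi>) (\<theta> s)" for s
  have xy_le: "blinfun_apply \<phi> x \<le> blinfun_apply \<phi> y" using mono xy by blast
  have \<theta>_mono: "\<theta> s \<le> \<theta> t" if "s \<le> t" for s t
    unfolding \<theta>_def using that xy_le by (simp add: mult_right_mono)
  have \<theta>: "\<theta> s \<in> blinfun_apply \<phi> ` C" if "s \<in> {0..1}" for s
    unfolding range using \<theta>_mono[of 0 s] \<theta>_mono[of s 1] that by (simp add: \<theta>_def)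
  have k: "k s \<in> C" "blinfun_apply \<phi> (k s) = \<theta> s" if "s \<in> {0..1}" for s
    unfolding k_def using \<theta>[OF that] by (auto intro: inv_into_into f_inv_into_f)
  have kI: "k s = c" if "c \<in> C" "\<theta> s = blinfun_apply \<phi> c" for s c
    unfolding k_def that(2) using inv_into_f_f[OF inj that(1)] .
  show ?thesis
  proof
    show "k 0 = x" "k 1 = y" using \<open>x \<in> C\<close> \<open>y \<in> C\<close> by (auto intro!: kI simp: \<theta>_def)
    show "k ` {0..1} \<subseteq> S" using k(1) C(1) by blast
    show "fun_le g (k s) (k t)" if "0 \<le> s" "s \<le> t" "t \<le> 1" for s t
      using that k[of s] k[of t] \<theta>_mono[of s t] by (intro order) auto
    fix h :: "'a \<Rightarrow>\<^sub>L real"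
    have "closed ((\<lambda>t. blinfun_apply h (k t)) -` B \<inter> {0..1})" if "closed B" for B
    proof -
      have "(\<lambda>t. blinfun_apply h (k t)) -` B \<inter> {0..1} =
          {0..1} \<inter> \<theta> -` (blinfun_apply \<phi> ` {c\<in>C. blinfun_apply h c \<in> B})"
        using k kI by (auto simp: image_iff) (metis (lifting))+
      moreover have "closed (\<theta> -` (blinfun_apply \<phi> ` {c\<in>C. blinfun_apply h c \<in> B}))"
        unfolding \<theta>_def by (intro closed_vimage compact_imp_closed img that continuous_intros)
      ultimately show ?thesis by (simp add: closed_Int)
    qed
    then show "continuous_on {0..1} (\<lambda>t. blinfun_apply h (k t))"
      by (subst continuous_on_closed_vimage) auto
  qed
qed

section \<open>Norm continuity and monotonicity for all extreme functionals\<close>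

lemma wstar_compact_mono_along:
  "wstar_compact {f\<in>cball (0::'a::real_normed_vector \<Rightarrow>\<^sub>L real) 1. mono_on {0..1::real} (\<lambda>t. blinfun_apply f (k t))}"
  "wstar_compact {f\<in>cball (0::'a::real_normed_vector \<Rightarrow>\<^sub>L real) 1. antimono_on {0..1::real} (\<lambda>t. blinfun_apply f (k t))}"
proof -
  have "closed {g::'a \<Rightarrow> real. mono_on {0..1::real} (\<lambda>t. g (k t))}"
    "closed {g::'a \<Rightarrow> real. antimono_on {0..1::real} (\<lambda>t. g (k t))}"
    unfolding monotone_on_def Ball_def
    by (intro closed_Collect_all closed_Collect_imp open_Collect_const closed_Collect_le continuous_intros; simp)+
  from this[THEN wstar_compact_Int_closed[OF wstar_compact_dual_ball]]
  show "wstar_compact {f\<in>cball (0::'a::real_normed_vector \<Rightarrow>\<^sub>L real) 1. mono_on {0..1::real} (\<lambda>t. blinfun_apply f (k t))}"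
    "wstar_compact {f\<in>cball (0::'a::real_normed_vector \<Rightarrow>\<^sub>L real) 1. antimono_on {0..1::real} (\<lambda>t. blinfun_apply f (k t))}"
    by simp_all
qed

text \<open>A form of Dini's theorem. For an increasing \<open>f\<close>, the increment over the interval of radius \<open>d\<close>
around \<open>t\<close> bounds the oscillation and shrinks with \<open>d\<close>. If for every radius some functional had an
increment of at least \<open>e\<close>, weak-star compactness would give a single functional with this property
for all radii, against its continuity along \<open>k\<close>. Both sides of \<open>t\<close> are treated at once;
the interval is clipped to \<open>[0, 1]\<close>.\<close>

lemma uniform_small_oscillation:
  fixes k :: "real \<Rightarrow> 'a::real_normed_vector"
  assumes wc: "\<And>h::'a \<Rightarrow>\<^sub>L real. continuous_on {0..1} (\<lambda>t. blinfun_apply h (k t))"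
    and t: "t \<in> {0..1}" and e: "(e::real) > 0"
  obtains d where "d > 0"
    "\<And>(f::'a \<Rightarrow>\<^sub>L real) s. f \<in> cball 0 1 \<Longrightarrow> mono_on {0..1} (\<lambda>t. blinfun_apply f (k t)) \<Longrightarrow> s \<in> {0..1} \<Longrightarrow> \<bar>s - t\<bar> \<le> d \<Longrightarrow>
      \<bar>blinfun_apply f (k s - k t)\<bar> < e"
proof -
  let ?P = "{f\<in>cball (0::'a \<Rightarrow>\<^sub>L real) 1. mono_on {0..1::real} (\<lambda>t. blinfun_apply f (k t))}"
  define lo hi where "lo = (\<lambda>m::nat. max 0 (t - 1 / Suc m))" and "hi = (\<lambda>m::nat. min 1 (t + 1 / Suc m))"
  have lohi: "lo m \<in> {0..1}" "hi m \<in> {0..1}" "lo m \<le> t" "t \<le> hi m" for m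
  proof -
    define r where "r = 1 / real (Suc m)"
    have "0 < r" by (simp add: r_def)
    then show "lo m \<in> {0..1}" "hi m \<in> {0..1}" "lo m \<le> t" "t \<le> hi m"
      using t unfolding lo_def hi_def r_def[symmetric] by auto
  qed
  have nested: "lo i \<le> lo j" "hi j \<le> hi i" if "i \<le> j" for i j
  proof -
    have "1 / real (Suc j) \<le> 1 / real (Suc i)" using that by (intro divide_left_mono) auto
    then show "lo i \<le> lo j" "hi j \<le> hi i" by (auto simp: lo_def hi_def)
  qed
  have lim: "lo \<longlonglongrightarrow> t" "hi \<longlonglongrightarrow> t"
  proof -
    have "(\<lambda>m. max 0 (t - 1 / real (Suc m))) \<longlonglongrightarrow> max 0 (t - 0)" "(\<lambda>m. min 1 (t + 1 / real (Suc m))) \<longlonglongrightarrow> min 1 (t + 0)"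
      using LIMSEQ_inverse_real_of_nat by (intro tendsto_intros; simp add: inverse_eq_divide)+
    then show "lo \<longlonglongrightarrow> t" "hi \<longlonglongrightarrow> t" using t by (simp_all add: lo_def hi_def)
  qed
  have "\<exists>m. \<forall>f\<in>?P. blinfun_apply f (k (hi m) - k (lo m)) < e"
  proof (rule ccontr)
    assume no: "\<nexists>m. \<forall>f\<in>?P. blinfun_apply f (k (hi m) - k (lo m)) < e"
    have "blinfun_apply ` ?P \<inter> (\<Inter>m\<in>UNIV. {g. e \<le> g (k (hi m) - k (lo m))}) \<noteq> {}"
    proof (rule compact_imp_fip_image)
      show "compact (blinfun_apply ` ?P)" using wstar_compact_mono_along(1) by (simp add: wstar_compact_def)
      show "closed {g. e \<le> g (k (hi m) - k (lo m))}" for m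
        by (intro closed_Collect_le continuous_intros)
      fix I :: "nat set" assume I: "finite I"
      obtain f where f: "f \<in> ?P" "e \<le> blinfun_apply f (k (hi (Max (insert 0 I))) - k (lo (Max (insert 0 I))))"
        using no by (meson not_less)
      have "e \<le> blinfun_apply f (k (hi i) - k (lo i))" if "i \<in> I" for i
      proof -
        have "i \<le> Max (insert 0 I)" using I that by simp
        from nested[OF this] f(1) lohi
        have "blinfun_apply f (k (hi (Max (insert 0 I)))) \<le> blinfun_apply f (k (hi i))"
          "blinfun_apply f (k (lo i)) \<le> blinfun_apply f (k (lo (Max (insert 0 I))))"
          by (auto simp: mono_on_def)
        then show ?thesis using f(2) by (simp add: blinfun.diff_right)
      qed
      then show "blinfun_apply ` ?P \<inter> (\<Inter>m\<in>I. {g. e \<le> g (k (hi m) - k (lo m))}) \<noteq> {}"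
        using f(1) by blast
    qed
    then obtain f :: "'a \<Rightarrow>\<^sub>L real" where f: "\<And>m. e \<le> blinfun_apply f (k (hi m) - k (lo m))" by auto
    have "(\<lambda>m. blinfun_apply f (k (hi m)) - blinfun_apply f (k (lo m))) \<longlonglongrightarrow> blinfun_apply f (k t) - blinfun_apply f (k t)"
      using lohi by (intro tendsto_diff continuous_on_tendsto_compose[OF wc] lim t) auto
    then have "e \<le> blinfun_apply f (k t) - blinfun_apply f (k t)"
      by (rule tendsto_lowerbound) (use f in \<open>auto simp: blinfun.diff_right\<close>)
    then show False using e by simp
  qed
  then obtain m where m: "\<And>f. f \<in> ?P \<Longrightarrow> blinfun_apply f (k (hi m) - k (lo m)) < e" by blast
  show ?thesis
  proof
    show "1 / real (Suc m) > 0" by simp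
    fix f :: "'a \<Rightarrow>\<^sub>L real" and s
    assume f: "f \<in> cball 0 1" "mono_on {0..1} (\<lambda>t. blinfun_apply f (k t))" and s: "s \<in> {0..1}" "\<bar>s - t\<bar> \<le> 1 / real (Suc m)"
    have "lo m \<le> s" "s \<le> hi m" using s by (auto simp: lo_def hi_def)
    then have "blinfun_apply f (k (lo m)) \<le> blinfun_apply f (k s)" "blinfun_apply f (k s) \<le> blinfun_apply f (k (hi m))"
      "blinfun_apply f (k (lo m)) \<le> blinfun_apply f (k t)" "blinfun_apply f (k t) \<le> blinfun_apply f (k (hi m))"
      using f(2) lohi[of m] s(1) t by (auto simp: mono_on_def)
    then show "\<bar>blinfun_apply f (k s - k t)\<bar> < e"
      using m[of f] f by (simp add: blinfun.diff_right)
  qed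
qed

lemma monotone_curveI:
  fixes k :: "real \<Rightarrow> 'a::real_normed_vector"
  assumes wc: "\<And>h::'a \<Rightarrow>\<^sub>L real. continuous_on {0..1} (\<lambda>t. blinfun_apply h (k t))"
    and T: "norming T" "T \<subseteq> cball 0 1"
    and mono: "\<And>f. f \<in> T \<Longrightarrow> mono_on {0..1} (\<lambda>t. blinfun_apply f (k t)) \<or> antimono_on {0..1} (\<lambda>t. blinfun_apply f (k t))"
  shows "monotone_curve k"
proof -
  let ?P = "{f\<in>cball (0::'a \<Rightarrow>\<^sub>L real) 1. mono_on {0..1::real} (\<lambda>t. blinfun_apply f (k t))}"
  let ?N = "{f\<in>cball (0::'a \<Rightarrow>\<^sub>L real) 1. antimono_on {0..1::real} (\<lambda>t. blinfun_apply f (k t))}"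
  have TPN: "T \<subseteq> ?P \<union> ?N" using T(2) mono by blast
  have "ext_dual \<subseteq> ?P \<union> ?N"
  proof (rule ext_dual_subset_norming)
    show "wstar_compact (?P \<union> ?N)"
      using wstar_compact_mono_along[of k] by (simp add: wstar_compact_def image_Un compact_Un)
    show "norming (?P \<union> ?N)" using T(1) TPN unfolding norming_def by blast
  qed auto
  moreover have "continuous_on {0..1} k"
    unfolding continuous_on_iff
  proof (intro ballI allI impI)
    fix t e :: real assume t: "t \<in> {0..1}" and "e > 0"
    obtain d where d: "d > 0" "\<And>(f::'a \<Rightarrow>\<^sub>L real) s. f \<in> cball 0 1 \<Longrightarrow> mono_on {0..1} (\<lambda>t. blinfun_apply f (k t)) \<Longrightarrow> s \<in> {0..1} \<Longrightarrow> \<bar>s - t\<bar> \<le> d \<Longrightarrow>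
      \<bar>blinfun_apply f (k s - k t)\<bar> < e / 2"
      using uniform_small_oscillation[OF wc t, of "e / 2"] \<open>e > 0\<close> by (metis half_gt_zero)
    have "dist (k s) (k t) < e" if s: "s \<in> {0..1}" "dist s t < d" for s
    proof -
      have "norm (k s - k t) \<le> e / 2"
      proof (rule norming_bound_imp_norm_le[OF T(1)])
        fix f assume "f \<in> T"
        then consider "f \<in> ?P" | "- f \<in> ?P"
          using TPN by (force simp: monotone_on_def blinfun.minus_left)
        then show "blinfun_apply f (k s - k t) \<le> e / 2"
          using d(2)[of f s] d(2)[of "- f" s] s by cases (auto simp: dist_real_def blinfun.minus_left)
      qed
      then show ?thesis using \<open>e > 0\<close> by (simp add: dist_norm)
    qed
    then show "\<exists>d>0. \<forall>s\<in>{0..1}. dist s t < d \<longrightarrow> dist (k s) (k t) < e" using d(1) by blast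
  qed
  ultimately show ?thesis unfolding monotone_curve_def path_def by blast
qed

theorem theorem2:
  fixes M :: "'a::banach set"
  assumes "separable_space (euclidean :: 'a topology)"
    and "M \<noteq> {}"
    and "boundedly_weakly_compact M"
    and "m_connected M"
  shows "monotone_path_connected M"
proof -
  obtain E :: "('a \<Rightarrow>\<^sub>L real) set" where E: "countable E" "E \<subseteq> cball 0 1" "norming E"
    and hull: "\<And>f x y z. f \<in> E \<Longrightarrow> z \<in> m_hull {x, y} \<Longrightarrow>
      blinfun_apply f z \<in> {min (blinfun_apply f x) (blinfun_apply f y)..max (blinfun_apply f x) (blinfun_apply f y)}"
    using countable_norming_hull_functionals[OF assms(1)] by blast
  have "E \<noteq> {}" using E(3) unfolding norming_def by (metis empty_iff zero_less_one)
  have "\<exists>k. monotone_curve k \<and> path_image k \<subseteq> M \<and> pathstart k = x \<and> pathfinish k = y"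
    if xy: "x \<in> M" "y \<in> M" for x y
  proof -
    define e where "e = from_nat_into E"
    have range_e: "range e = E" unfolding e_def using E(1) \<open>E \<noteq> {}\<close> by (rule range_from_nat_into[rotated])
    \<comment> \<open>The signs are chosen so that no functional decreases from \<open>x\<close> to \<open>y\<close>.\<close>
    define g where "g n = (if blinfun_apply (e n) x \<le> blinfun_apply (e n) y then e n else - e n)" for n
    have e: "e n \<in> E" for n using range_e by blast
    have g_cases: "g n = e n \<or> g n = - e n" for n by (simp add: g_def)
    have g_ball: "g n \<in> cball 0 1" for n
      using g_cases[of n] E(2) e[of n] by (auto simp: subset_iff)
    have sep: "u = v" if "\<forall>n. blinfun_apply (g n) u = blinfun_apply (g n) v" for u v
    proof (rule norming_separates[OF E(3)])
      fix f assume "f \<in> E"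
      then obtain n where "f = e n" using range_e by blast
      then show "blinfun_apply f u = blinfun_apply f v"
        using g_cases[of n] that by (auto simp: blinfun.minus_left dest!: spec[of _ n])
    qed
    have g_hull: "fun_le g u w \<and> fun_le g w v" if "w \<in> m_hull {u, v}" "fun_le g u v" for u v w
    proof -
      have "blinfun_apply (g n) u \<le> blinfun_apply (g n) w \<and> blinfun_apply (g n) w \<le> blinfun_apply (g n) v" for n
        using hull[OF e[of n] that(1)] that(2) g_cases[of n]
        by (auto simp: fun_le_def blinfun.minus_left min_def max_def split: if_splits dest!: spec[of _ n])
      then show ?thesis by (simp add: fun_le_def)
    qed
    \<comment> \<open>Intersecting with this ball makes the interval weakly compact, and the ball contains the
      ball hull of any two of its points, so it keeps the points between them.\<close>
    define S where "S = (M \<inter> cball x (dist x y)) \<inter> ({z. fun_le g x z} \<inter> {z. fun_le g z y})"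
    have gxy: "fun_le g x y" by (auto simp: fun_le_def g_def blinfun.minus_left)
    have S_sub: "S \<subseteq> M" "S \<subseteq> cball x (dist x y)" by (auto simp: S_def)
    have S_bounds: "fun_le g x z \<and> fun_le g z y" if "z \<in> S" for z
      using that by (simp add: S_def)
    have "compactin weak_topology (M \<inter> cball x (dist x y))"
      using assms(3) by (simp add: boundedly_weakly_compact_def)
    then have S_compact: "compactin weak_topology S"
      unfolding S_def by (rule compact_Int_closedin) (intro closedin_Int closedin_fun_le)
    have S_ends: "x \<in> S" "y \<in> S" using xy gxy by (auto simp: S_def)
    have S_dense: "\<exists>w\<in>S. w \<noteq> u \<and> w \<noteq> v \<and> fun_le g u w \<and> fun_le g w v"
      if uv: "u \<in> S" "v \<in> S" "fun_le g u v" "u \<noteq> v" for u v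
    proof -
      have "u \<in> M" "v \<in> M" using uv S_sub by auto
      then have "m_hull {u, v} \<inter> M \<noteq> {u, v}"
        using assms(4) uv(4) unfolding m_connected_def by blast
      moreover have "{u, v} \<subseteq> m_hull {u, v} \<inter> M"
        using \<open>u \<in> M\<close> \<open>v \<in> M\<close> unfolding m_hull_def by blast
      ultimately obtain w where w: "w \<in> m_hull {u, v}" "w \<in> M" "w \<noteq> u" "w \<noteq> v" by blast
      have "m_hull {u, v} \<subseteq> cball x (dist x y)"
        using uv S_sub unfolding m_hull_def by blast
      moreover have "fun_le g x w" "fun_le g w y"
        using g_hull[OF w(1) uv(3)] S_bounds[OF uv(1)] S_bounds[OF uv(2)] fun_le_trans by blast+
      ultimately have "w \<in> S" using w(1,2) by (auto simp: S_def)
      then show ?thesis using w g_hull[OF w(1) uv(3)] by blast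
    qed
    obtain k :: "real \<Rightarrow> 'a" where k: "k 0 = x" "k 1 = y" "k ` {0..1} \<subseteq> S"
      "\<And>s t. 0 \<le> s \<Longrightarrow> s \<le> t \<Longrightarrow> t \<le> 1 \<Longrightarrow> fun_le g (k s) (k t)"
      "\<And>h::'a \<Rightarrow>\<^sub>L real. continuous_on {0..1} (\<lambda>t. blinfun_apply h (k t))"
      by (rule order_arc[of g S x y]; (rule g_ball sep S_compact S_ends S_bounds S_dense that; assumption))
    have "monotone_curve k"
    proof (rule monotone_curveI[OF k(5) E(3,2)])
      fix f assume "f \<in> E"
      then obtain n where f: "f = e n" using range_e by blast
      have "mono_on {0..1} (\<lambda>t. blinfun_apply (g n) (k t))"
        using k(4) by (auto simp: mono_on_def fun_le_def)
      then show "mono_on {0..1} (\<lambda>t. blinfun_apply f (k t)) \<or> antimono_on {0..1} (\<lambda>t. blinfun_apply f (k t))"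
        using g_cases[of n] f by (auto simp: monotone_on_def blinfun.minus_left)
    qed
    moreover have "path_image k \<subseteq> M" using k(3) by (auto simp: path_image_def S_def)
    ultimately show ?thesis using k(1,2) by (auto simp: pathstart_def pathfinish_def)
  qed
  moreover have "closed M" by (rule boundedly_weakly_compact_imp_closed[OF assms(3) E(3)])
  ultimately show ?thesis unfolding monotone_path_connected_def by blast
qed

end
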